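(* Let $a$ and $b$ be relatively prime integers with $a>b\ge 1$, and let $S=\{a,b\}$. The dead ends in $\mathbb{Z}$ with respect to $S$ (equivalently, the maximal Frobenius values with respect to $S$) are as follows. (i) If $a+b$ is even, there are exactly $b-1$ dead ends, they are all strict, they all have length $(a+b)/2$, and they are the integers \[ d=\frac{(a+b)(2\alpha-b)}{2},\qquad \alpha=1,2,\dots,b-1. \] (ii) If $a+b$ is odd, there are exactly $2(b-1)$ dead ends, none of them is strict, they all have length $(a+b-1)/2$, and they are the integers \[ d=\frac{(a+b)(2\alpha-b)\pm b}{2},\qquad \alpha=1,2,\dots,b-1. \]
   Context: For a finite generating set $S$ of $\mathbb{Z}$, the length $\ell(n)$ of $n\in\mathbb{Z}$ is the least $k$ such that $n=s_1+\dots+s_k$ with each $s_i\in S\cup(-S)$ (the distance from $0$ to $n$ in the Cayley graph $\Gamma(\mathbb{Z},S)$, where $m,n$ are adjacent iff $m-n\in S\cup(-S)$). A dead end is an integer $d$ with $\ell(d+s)\le\ell(d)$ for all $s\in S\cup(-S)$; it is strict if $\ell(d+s)<\ell(d)$ for all $s\in S\cup(-S)$. An integer is a Frobenius value with respect to $S$ if it is neither a non-negative nor a non-positive integer linear combination of elements of $S$. The Cayley order: $g\le h$ iff some geodesic in $\Gamma(\mathbb{Z},S)$ from $0$ to $h$ passes through $g$; a maximal Frobenius value is a Frobenius value $c$ such that no Frobenius value $c'\neq c$ satisfies $c\le c'$. *)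

theory Defs
  imports Complex_Main
begin

definition symgen :: "int set \<Rightarrow> int set" where
  "symgen S = S \<union> uminus ` S"

definition word_length :: "int set \<Rightarrow> int \<Rightarrow> nat" where
  "word_length S n =
     (LEAST k. \<exists>xs. length xs = k \<and> set xs \<subseteq> symgen S \<and> sum_list xs = n)"

definition dead_end :: "int set \<Rightarrow> int \<Rightarrow> bool" where
  "dead_end S d \<longleftrightarrow> (\<forall>s\<in>symgen S. word_length S (d + s) \<le> word_length S d)"

definition strict_dead_end :: "int set \<Rightarrow> int \<Rightarrow> bool" where
  "strict_dead_end S d \<longleftrightarrow> (\<forall>s\<in>symgen S. word_length S (d + s) < word_length S d)"

definition frobenius_value :: "int set \<Rightarrow> int \<Rightarrow> bool" where
  "frobenius_value S n \<longleftrightarrow>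
     \<not> (\<exists>c::int \<Rightarrow> int. (\<forall>s\<in>S. c s \<ge> 0) \<and> n = (\<Sum>s\<in>S. c s * s)) \<and>
     \<not> (\<exists>c::int \<Rightarrow> int. (\<forall>s\<in>S. c s \<le> 0) \<and> n = (\<Sum>s\<in>S. c s * s))"

definition cayley_adj :: "int set \<Rightarrow> int \<Rightarrow> int \<Rightarrow> bool" where
  "cayley_adj S m n \<longleftrightarrow> m - n \<in> symgen S"

text \<open>A walk is the nonempty list of the vertices it visits, in order.\<close>

definition cayley_walk :: "int set \<Rightarrow> int \<Rightarrow> int \<Rightarrow> int list \<Rightarrow> bool" where
  "cayley_walk S u v p \<longleftrightarrow>
     p \<noteq> [] \<and> hd p = u \<and> last p = v \<and> successively (cayley_adj S) p"

definition cayley_geodesic :: "int set \<Rightarrow> int \<Rightarrow> int \<Rightarrow> int list \<Rightarrow> bool" where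
  "cayley_geodesic S u v p \<longleftrightarrow>
     cayley_walk S u v p \<and> (\<forall>q. cayley_walk S u v q \<longrightarrow> length p \<le> length q)"

definition cayley_le :: "int set \<Rightarrow> int \<Rightarrow> int \<Rightarrow> bool" where
  "cayley_le S g h \<longleftrightarrow> (\<exists>p. cayley_geodesic S 0 h p \<and> g \<in> set p)"

definition maximal_frobenius_value :: "int set \<Rightarrow> int \<Rightarrow> bool" where
  "maximal_frobenius_value S c \<longleftrightarrow>
     frobenius_value S c \<and>
     \<not> (\<exists>c'. frobenius_value S c' \<and> c' \<noteq> c \<and> cayley_le S c c')"

end

theory Submission
  imports Defs
begin

text \<open>
  Every integer is \<open>x * a + y * b\<close> with \<open>0 \<le> y < a\<close> for a unique pair, and since \<open>a > b\<close> its length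
  is \<open>min (\<bar>x\<bar> + y) (\<bar>x + b\<bar> + a - y)\<close>, the smaller of the norms of the two representations
  whose \<open>b\<close>-coordinate is next to 0. The Frobenius values are the points \<open>y * b - p * a\<close> of the open
  rectangle \<open>0 < p < b\<close>, \<open>0 < y < a\<close>. On the closed rectangle the length depends on \<open>s = p + y\<close> only:
  it is \<open>min s (a + b - s)\<close>, while a generator changes \<open>s\<close> by one. So the dead ends inside the
  rectangle are the points with \<open>s\<close> as close as possible to \<open>(a + b) / 2\<close>; outside it the length can
  always be increased.
\<close>

section \<open>Word length and walks\<close>

text \<open>Ensures that the \<open>LEAST\<close> in \<open>word_length\<close> ranges over a
  nonempty set, so that it is attained.\<close>

definition generates :: "int set \<Rightarrow> bool" where
  "generates S \<longleftrightarrow> (\<forall>n. \<exists>xs. set xs \<subseteq> symgen S \<and> sum_list xs = n)"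

lemma word_length_le:
  assumes "set xs \<subseteq> symgen S" "sum_list xs = n"
  shows "word_length S n \<le> length xs"
  unfolding word_length_def by (rule Least_le) (use assms in blast)

lemma word_length_witness:
  assumes "generates S"
  obtains xs where "length xs = word_length S n" "set xs \<subseteq> symgen S" "sum_list xs = n"
proof -
  have "\<exists>k xs. length xs = k \<and> set xs \<subseteq> symgen S \<and> sum_list xs = n"
    using assms unfolding generates_def by blast
  then have "\<exists>xs. length xs = word_length S n \<and> set xs \<subseteq> symgen S \<and> sum_list xs = n"
    unfolding word_length_def by (rule LeastI_ex)
  then show ?thesis using that by blast
qed

lemma word_length_add:
  assumes "generates S"
  shows "word_length S (m + n) \<le> word_length S m + word_length S n"
proof -
  obtain xs where xs: "length xs = word_length S m" "set xs \<subseteq> symgen S" "sum_list xs = m"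
    using word_length_witness[OF assms] .
  obtain ys where ys: "length ys = word_length S n" "set ys \<subseteq> symgen S" "sum_list ys = n"
    using word_length_witness[OF assms] .
  have "word_length S (m + n) \<le> length (xs @ ys)"
    by (rule word_length_le) (use xs ys in auto)
  with xs ys show ?thesis by simp
qed

lemma uminus_symgen: "s \<in> symgen S \<Longrightarrow> - s \<in> symgen S"
  by (auto simp: symgen_def)

section \<open>Walks and geodesics in the Cayley graph\<close>

lemma cayley_adj_sym: "cayley_adj S m n \<longleftrightarrow> cayley_adj S n m"
  unfolding cayley_adj_def by (metis minus_diff_eq uminus_symgen)

text \<open>The differences of consecutive vertices form a word for \<open>v - u\<close>; a walk
  lists one more vertex than it has edges, hence the \<open>+ 1\<close>.\<close>

lemma word_length_le_walk:
  assumes "cayley_walk S u v p"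
  shows "word_length S (v - u) + 1 \<le> length p"
proof -
  have "\<exists>xs. length xs + 1 = length p \<and> set xs \<subseteq> symgen S \<and> sum_list xs = v - u"
    using assms
  proof (induction p arbitrary: u)
    case Nil
    then show ?case by (simp add: cayley_walk_def)
  next
    case (Cons w p)
    show ?case
    proof (cases p)
      case Nil
      with Cons.prems show ?thesis by (auto simp: cayley_walk_def)
    next
      case (Cons w' p')
      have "w = u" and adj: "cayley_adj S u w'" and "cayley_walk S w' v p"
        using Cons.prems Cons by (auto simp: cayley_walk_def)
      then obtain xs where "length xs + 1 = length p" "set xs \<subseteq> symgen S" "sum_list xs = v - w'"
        using Cons.IH by blast
      moreover have "w' - u \<in> symgen S"
        using adj cayley_adj_sym cayley_adj_def by blast
      ultimately show ?thesis
        by (intro exI[of _ "(w' - u) # xs"]) auto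
    qed
  qed
  then obtain xs where "length xs + 1 = length p" "set xs \<subseteq> symgen S" "sum_list xs = v - u"
    by blast
  then show ?thesis using word_length_le by fastforce
qed

lemma walk_of_word:
  assumes "set xs \<subseteq> symgen S"
  shows "\<exists>p. cayley_walk S u (u + sum_list xs) p \<and> length p = length xs + 1"
  using assms
proof (induction xs arbitrary: u)
  case Nil
  then show ?case by (intro exI[of _ "[u]"]) (simp add: cayley_walk_def)
next
  case (Cons x xs)
  then obtain p where p: "cayley_walk S (u + x) (u + x + sum_list xs) p" "length p = length xs + 1"
    by (metis insert_subset list.simps(15))
  moreover have "cayley_adj S u (u + x)"
    using Cons.prems by (simp add: cayley_adj_def uminus_symgen)
  ultimately show ?case
    by (intro exI[of _ "u # p"]) (auto simp: cayley_walk_def successively_Cons add.assoc)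
qed

lemma shortest_walk:
  assumes "generates S"
  obtains p where "cayley_walk S u v p" "length p = word_length S (v - u) + 1"
proof -
  obtain xs where "length xs = word_length S (v - u)" "set xs \<subseteq> symgen S" "sum_list xs = v - u"
    using word_length_witness[OF assms] .
  with walk_of_word[of xs S u] that show ?thesis by auto
qed

lemma cayley_geodesic_iff:
  assumes "generates S"
  shows "cayley_geodesic S u v p \<longleftrightarrow>
    cayley_walk S u v p \<and> length p = word_length S (v - u) + 1"
proof -
  obtain q where "cayley_walk S u v q" "length q = word_length S (v - u) + 1"
    using shortest_walk[OF assms] .
  then show ?thesis
    unfolding cayley_geodesic_def by (metis word_length_le_walk le_antisym)
qed

text \<open>A geodesic through \<open>c\<close> to another vertex would leave \<open>c\<close> for a
  neighbour \<open>e\<close> that is farther from 0, which a dead end forbids.\<close>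

lemma cayley_le_dead_end:
  assumes gen: "generates S" and dead: "dead_end S c" and le: "cayley_le S c h"
  shows "h = c"
proof (rule ccontr)
  assume "h \<noteq> c"
  obtain p where p: "cayley_walk S 0 h p" "length p = word_length S h + 1" "c \<in> set p"
    using le unfolding cayley_le_def cayley_geodesic_iff[OF gen] by auto
  obtain us vs where p_eq: "p = us @ c # vs" using p(3) by (meson split_list)
  have "vs \<noteq> []" using p(1) \<open>h \<noteq> c\<close> by (auto simp: p_eq cayley_walk_def)
  then obtain e ws where vs: "vs = e # ws" by (cases vs) auto
  have "cayley_adj S c e" and tail: "cayley_walk S e h vs"
    using p(1) by (auto simp: p_eq vs cayley_walk_def successively_append_iff)
  then have "e - c \<in> symgen S" using cayley_adj_sym cayley_adj_def by blast
  then have "word_length S e \<le> word_length S c"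
    using dead unfolding dead_end_def by (metis diff_add_cancel add.commute)
  \<comment> \<open>The part up to \<open>c\<close> bounds the length of \<open>c\<close>, the part
    from \<open>e\<close> on that of \<open>h - e\<close>. As \<open>e\<close> is no longer than
    \<open>c\<close>, the edge from \<open>c\<close> to \<open>e\<close> is wasted and
    \<open>h\<close> can be reached with one edge fewer.\<close>
  moreover have "cayley_walk S 0 c (us @ [c])"
    using p(1) unfolding p_eq vs cayley_walk_def
    by (cases us) (auto simp: successively_append_iff successively_Cons hd_append split: if_splits)
  then have "word_length S c \<le> length us" using word_length_le_walk by fastforce
  moreover have "word_length S (h - e) \<le> length ws"
    using word_length_le_walk[OF tail] vs by simp
  moreover have "word_length S h \<le> word_length S e + word_length S (h - e)"
    using word_length_add[OF gen, of e "h - e"] by simp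
  moreover have "word_length S h = length us + 1 + length ws"
    using p(2) p_eq vs by simp
  ultimately show False by linarith
qed

text \<open>A geodesic to \<open>c\<close> prolonged by one edge has
  \<open>word_length S c + 1\<close> edges, the fewest possible for a longer endpoint.\<close>

lemma cayley_le_neighbour:
  assumes gen: "generates S" and s: "s \<in> symgen S"
    and longer: "word_length S c < word_length S (c + s)"
  shows "cayley_le S c (c + s)"
proof -
  obtain p where p: "cayley_walk S 0 c p" "length p = word_length S c + 1"
    using shortest_walk[OF gen, of 0 c] by auto
  have "cayley_adj S c (c + s)" using s by (simp add: cayley_adj_def uminus_symgen)
  then have walk: "cayley_walk S 0 (c + s) (p @ [c + s])"
    using p(1) by (auto simp: cayley_walk_def successively_append_iff)
  moreover have "length (p @ [c + s]) = word_length S (c + s) + 1"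
    using word_length_le_walk[OF walk] p(2) longer by simp
  moreover have "c \<in> set (p @ [c + s])"
    using p(1) by (auto simp: cayley_walk_def)
  ultimately show ?thesis
    unfolding cayley_le_def cayley_geodesic_iff[OF gen] by (metis diff_zero)
qed

section \<open>Two coprime generators\<close>

text \<open>Opposite letters cancel in the coordinates, so the norm may be below the number of
  letters. Together with \<open>word_of_norm\<close> this makes the length of an integer the least
  norm of its representations.\<close>

lemma word_two_generators_norm:
  "set xs \<subseteq> symgen {a, b} \<Longrightarrow>
    \<exists>x y. sum_list xs = x * a + y * b \<and> \<bar>x\<bar> + \<bar>y\<bar> \<le> int (length xs)"
proof (induction xs)
  case Nil
  then show ?case by (intro exI[of _ 0]) simp
next
  case (Cons g xs)
  then obtain x y where xy: "sum_list xs = x * a + y * b" "\<bar>x\<bar> + \<bar>y\<bar> \<le> int (length xs)"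
    by auto
  from Cons.prems consider "g = a" | "g = - a" | "g = b" | "g = - b"
    by (auto simp: symgen_def)
  then show ?case
  proof cases
    case 1
    show ?thesis by (rule exI[of _ "x + 1"], rule exI[of _ y]) (use xy 1 in \<open>auto simp: algebra_simps\<close>)
  next
    case 2
    show ?thesis by (rule exI[of _ "x - 1"], rule exI[of _ y]) (use xy 2 in \<open>auto simp: algebra_simps\<close>)
  next
    case 3
    show ?thesis by (rule exI[of _ x], rule exI[of _ "y + 1"]) (use xy 3 in \<open>auto simp: algebra_simps\<close>)
  next
    case 4
    show ?thesis by (rule exI[of _ x], rule exI[of _ "y - 1"]) (use xy 4 in \<open>auto simp: algebra_simps\<close>)
  qed
qed

lemma word_of_norm:
  fixes a b :: int
  shows "\<exists>xs. set xs \<subseteq> symgen {a, b} \<and> sum_list xs = x * a + y * b \<and> int (length xs) = \<bar>x\<bar> + \<bar>y\<bar>"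
proof -
  have rep: "sum_list (replicate (nat \<bar>z\<bar>) (sgn z * c)) = z * c" for z c :: int
    by (simp add: sum_list_replicate abs_mult_sgn flip: mult.assoc)
  \<comment> \<open>If \<open>x = 0\<close>, the entry \<open>sgn x * a\<close> is 0 and need not be
    a generator, but then the list is empty.\<close>
  have "set (replicate (nat \<bar>x\<bar>) (sgn x * a)) \<subseteq> symgen {a, b}"
    "set (replicate (nat \<bar>y\<bar>) (sgn y * b)) \<subseteq> symgen {a, b}"
    by (auto simp: symgen_def sgn_if)
  then show ?thesis
    by (intro exI[of _ "replicate (nat \<bar>x\<bar>) (sgn x * a) @ replicate (nat \<bar>y\<bar>) (sgn y * b)"])
      (simp add: rep)
qed

lemma ball_symgen_two:
  "(\<forall>s\<in>symgen {a, b}. P s) \<longleftrightarrow> P a \<and> P (- a) \<and> P b \<and> P (- b)"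
  by (auto simp: symgen_def)

locale coprime_pair =
  fixes a b :: int
  assumes coprime: "coprime a b" and b_pos: "b \<ge> 1" and less: "a > b"
begin

abbreviation len :: "int \<Rightarrow> int" where
  "len n \<equiv> int (word_length {a, b} n)"

section \<open>Representations of integers and the length formula\<close>

lemma representation:
  obtains x y where "0 \<le> y" "y < a" "n = x * a + y * b"
proof -
  obtain u v where "u * a + v * b = 1"
    using bezout_int[of a b] coprime by (auto simp: coprime_iff_gcd_eq_1)
  then have "n = (n * u) * a + (n * v) * b"
    by (metis mult.assoc distrib_left mult.right_neutral)
  \<comment> \<open>The quotient by \<open>a\<close> moves into the other coefficient, since
    \<open>(q * a) * b = (q * b) * a\<close>.\<close>
  also have "n * v = (n * v) div a * a + (n * v) mod a" by simp
  finally have "n = (n * u + (n * v) div a * b) * a + ((n * v) mod a) * b"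
    by (simp only: distrib_left distrib_right mult.assoc add.assoc mult.commute[of a b])
  moreover have "0 \<le> (n * v) mod a" "(n * v) mod a < a" using b_pos less by auto
  ultimately show ?thesis using that by blast
qed

lemma representation_unique:
  assumes "x' * a + y' * b = x * a + y * b"
  obtains t where "x' = x + t * b" "y' = y - t * a"
proof -
  have eq: "(x' - x) * a = (y - y') * b" using assms by (simp add: algebra_simps)
  then have "b dvd (x' - x) * a" by simp
  then have "b dvd x' - x"
    using coprime by (metis coprime_commute coprime_dvd_mult_left_iff)
  then obtain t where t: "x' - x = b * t" ..
  with eq have "(y - y') * b = (t * a) * b" by (simp add: algebra_simps)
  then have "y - y' = t * a" using b_pos by simp
  with t show ?thesis by (intro that[of t]) (auto simp: algebra_simps)
qed

lemma generates: "generates {a, b}"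
  unfolding generates_def by (metis representation word_of_norm)

lemma len_le: "len (x * a + y * b) \<le> \<bar>x\<bar> + \<bar>y\<bar>"
  using word_of_norm[of a b x y] word_length_le by fastforce

text \<open>The representations are \<open>(x + t * b, y - t * a)\<close>. Moving \<open>t\<close>
  down from 0 or up from 1 costs \<open>a\<close> per step in the second coordinate and gains at
  most \<open>b < a\<close> in the first, so only \<open>t = 0\<close> and \<open>t = 1\<close>
  compete. The case \<open>y = a\<close> is included because neighbours of points of the open
  rectangle may land there.\<close>

lemma len_eq:
  assumes "0 \<le> y" "y \<le> a"
  shows "len (x * a + y * b) = min (\<bar>x\<bar> + y) (\<bar>x + b\<bar> + a - y)"
proof (rule antisym)
  have "(x + b) * a + (y - a) * b = x * a + y * b" by (simp add: algebra_simps)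
  then show "len (x * a + y * b) \<le> min (\<bar>x\<bar> + y) (\<bar>x + b\<bar> + a - y)"
    using len_le[of x y] len_le[of "x + b" "y - a"] assms by auto
next
  obtain xs where xs: "length xs = word_length {a, b} (x * a + y * b)"
      "set xs \<subseteq> symgen {a, b}" "sum_list xs = x * a + y * b"
    using word_length_witness[OF generates] .
  obtain x' y' where xy': "sum_list xs = x' * a + y' * b" "\<bar>x'\<bar> + \<bar>y'\<bar> \<le> int (length xs)"
    using word_two_generators_norm[OF xs(2)] by blast
  obtain t where t: "x' = x + t * b" "y' = y - t * a"
    using representation_unique[of x' y' x y] xs(3) xy'(1) by auto
  have "min (\<bar>x\<bar> + y) (\<bar>x + b\<bar> + a - y) \<le> \<bar>x'\<bar> + \<bar>y'\<bar>"
  proof (cases "t \<le> 0")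
    case True
    then have "(- t) * b \<le> (- t) * a" "0 \<le> (- t) * b"
      using less b_pos by (intro mult_left_mono mult_nonneg_nonneg; simp)+
    then have "\<bar>x\<bar> + y \<le> \<bar>x'\<bar> + \<bar>y'\<bar>" using t by linarith
    then show ?thesis by simp
  next
    case False
    then have "(t - 1) * b \<le> (t - 1) * a" "0 \<le> (t - 1) * b"
      using less b_pos by (intro mult_left_mono mult_nonneg_nonneg; simp)+
    \<comment> \<open>Recentred at \<open>t = 1\<close>: the second coordinate \<open>y - a\<close>
      is nonpositive there, so lowering it raises its absolute value.\<close>
    moreover have "x' = (x + b) + (t - 1) * b" "y' = (y - a) - (t - 1) * a"
      using t by (auto simp: algebra_simps)
    ultimately have "\<bar>x + b\<bar> + a - y \<le> \<bar>x'\<bar> + \<bar>y'\<bar>" by linarith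
    then show ?thesis by simp
  qed
  then show "min (\<bar>x\<bar> + y) (\<bar>x + b\<bar> + a - y) \<le> len (x * a + y * b)"
    using xy'(2) xs(1) by simp
qed

lemma len_rectangle:
  assumes "0 \<le> p" "p \<le> b" "0 \<le> y" "y \<le> a"
  shows "len (y * b - p * a) = min (p + y) (a + b - (p + y))"
  using len_eq[of y "- p"] assms by (simp add: algebra_simps)

section \<open>Dead ends and the open rectangle\<close>

definition inner :: "int \<Rightarrow> int \<Rightarrow> bool" where
  "inner p y \<longleftrightarrow> 1 \<le> p \<and> p \<le> b - 1 \<and> 1 \<le> y \<and> y \<le> a - 1"

text \<open>Neighbours of a point of the open rectangle stay in the closed one, where
  \<open>len_rectangle\<close> applies. Adding \<open>a\<close> or \<open>- b\<close> lowers
  \<open>p + y\<close> by one; the other two generators raise it.\<close>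

lemma inner_neighbours:
  assumes "inner p y" and "d = y * b - p * a"
  shows "len d = min (p + y) (a + b - (p + y))"
    and "len (d + a) = min (p + y - 1) (a + b - (p + y - 1))"
    and "len (d - a) = min (p + y + 1) (a + b - (p + y + 1))"
    and "len (d + b) = min (p + y + 1) (a + b - (p + y + 1))"
    and "len (d - b) = min (p + y - 1) (a + b - (p + y - 1))"
proof -
  have eq: "d + a = y * b - (p - 1) * a" "d - a = y * b - (p + 1) * a"
    "d + b = (y + 1) * b - p * a" "d - b = (y - 1) * b - p * a"
    using assms(2) by (auto simp: algebra_simps)
  show "len d = min (p + y) (a + b - (p + y))"
    using assms by (simp add: len_rectangle inner_def)
  show "len (d + a) = min (p + y - 1) (a + b - (p + y - 1))"
    "len (d - a) = min (p + y + 1) (a + b - (p + y + 1))"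
    "len (d + b) = min (p + y + 1) (a + b - (p + y + 1))"
    "len (d - b) = min (p + y - 1) (a + b - (p + y - 1))"
    unfolding eq using assms(1)
    by (subst len_rectangle; simp add: inner_def algebra_simps)+
qed

lemma dead_end_iff_len:
  "dead_end {a, b} d \<longleftrightarrow>
    len (d + a) \<le> len d \<and> len (d - a) \<le> len d \<and> len (d + b) \<le> len d \<and> len (d - b) \<le> len d"
  unfolding dead_end_def ball_symgen_two by simp

lemma strict_dead_end_iff_len:
  "strict_dead_end {a, b} d \<longleftrightarrow>
    len (d + a) < len d \<and> len (d - a) < len d \<and> len (d + b) < len d \<and> len (d - b) < len d"
  unfolding strict_dead_end_def ball_symgen_two by simp

text \<open>The function \<open>min s (a + b - s)\<close> is a tent with peak at
  \<open>(a + b) / 2\<close>; an integer \<open>s\<close> is a local maximum exactly when it lies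
  within 1/2 of the peak.\<close>

lemma dead_end_inner_iff:
  assumes "inner p y"
  shows "dead_end {a, b} (y * b - p * a) \<longleftrightarrow> \<bar>2 * (p + y) - (a + b)\<bar> \<le> 1"
  unfolding dead_end_iff_len inner_neighbours[OF assms refl] min_def by (smt (verit))

text \<open>For odd \<open>a + b\<close> the two integers next to the peak are adjacent and have
  equal height, so neither is a strict maximum.\<close>

lemma strict_dead_end_inner_iff:
  assumes "inner p y"
  shows "strict_dead_end {a, b} (y * b - p * a) \<longleftrightarrow> 2 * (p + y) = a + b"
  unfolding strict_dead_end_iff_len inner_neighbours[OF assms refl] min_def by (smt (verit))

lemma dead_end_is_inner:
  assumes dead: "dead_end {a, b} d"
  obtains p y where "inner p y" "d = y * b - p * a"
proof -
  obtain x y where xy: "0 \<le> y" "y < a" "d = x * a + y * b"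
    using representation .
  have eq: "d + a = (x + 1) * a + y * b" "d - a = (x - 1) * a + y * b"
    "d + b = x * a + (y + 1) * b"
    using xy(3) by (auto simp: algebra_simps)
  have len: "len d = min (\<bar>x\<bar> + y) (\<bar>x + b\<bar> + a - y)"
    "len (d + a) = min (\<bar>x + 1\<bar> + y) (\<bar>x + 1 + b\<bar> + a - y)"
    "len (d - a) = min (\<bar>x - 1\<bar> + y) (\<bar>x - 1 + b\<bar> + a - y)"
    "len (d + b) = min (\<bar>x\<bar> + (y + 1)) (\<bar>x + b\<bar> + a - (y + 1))"
    unfolding eq using xy by (auto simp: len_eq)
  have le: "len (d + a) \<le> len d" "len (d - a) \<le> len d" "len (d + b) \<le> len d"
    using dead by (auto simp: dead_end_iff_len)
  \<comment> \<open>If \<open>x \<ge> 0\<close>, adding \<open>a\<close> raises both entries of the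
    minimum; if \<open>x \<le> - b\<close>, subtracting \<open>a\<close> does.\<close>
  have "x < 0"
    using le(1) b_pos unfolding len min_def by (smt (verit))
  moreover have "x > - b"
    using le(2) b_pos unfolding len min_def by (smt (verit))
  \<comment> \<open>If \<open>y = 0\<close>, then \<open>len d = \<bar>x\<bar> < b < a\<close>.
    Adding \<open>b\<close> makes the first entry \<open>\<bar>x\<bar> + 1\<close> and leaves the
    second at least \<open>a\<close>, so the length would grow.\<close>
  ultimately have "y \<noteq> 0"
    using le(3) less unfolding len min_def by (smt (verit))
  with \<open>x < 0\<close> \<open>x > - b\<close> have "inner (- x) y" using xy by (auto simp: inner_def)
  then show ?thesis using that[of "- x" y] xy(3) by simp
qed

lemma dead_end_iff:
  "dead_end {a, b} d \<longleftrightarrow>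
    (\<exists>p y. inner p y \<and> d = y * b - p * a \<and> \<bar>2 * (p + y) - (a + b)\<bar> \<le> 1)"
  using dead_end_is_inner dead_end_inner_iff by metis

section \<open>Frobenius values and their maximality\<close>

lemma frobenius_value_iff:
  "frobenius_value {a, b} n \<longleftrightarrow> (\<exists>p y. inner p y \<and> n = y * b - p * a)"
proof -
  have ab: "a \<noteq> b" "a > 0" using less b_pos by auto
  \<comment> \<open>The predicate \<open>P\<close> serves both signs; the sum splits into two terms
    because \<open>a \<noteq> b\<close>.\<close>
  have comb: "(\<exists>c::int \<Rightarrow> int. (\<forall>s\<in>{a, b}. P (c s)) \<and> n = (\<Sum>s\<in>{a, b}. c s * s)) \<longleftrightarrow>
      (\<exists>u v. P u \<and> P v \<and> n = u * a + v * b)" for P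
  proof
    assume "\<exists>u v. P u \<and> P v \<and> n = u * a + v * b"
    then obtain u v where "P u" "P v" "n = u * a + v * b" by blast
    then show "\<exists>c::int \<Rightarrow> int. (\<forall>s\<in>{a, b}. P (c s)) \<and> n = (\<Sum>s\<in>{a, b}. c s * s)"
      using ab by (intro exI[of _ "\<lambda>s. if s = a then u else v"]) auto
  qed (use ab in auto)
  have frob: "frobenius_value {a, b} n \<longleftrightarrow>
      \<not> (\<exists>u v. u \<ge> 0 \<and> v \<ge> 0 \<and> n = u * a + v * b) \<and>
      \<not> (\<exists>u v. u \<le> 0 \<and> v \<le> 0 \<and> n = u * a + v * b)"
    unfolding frobenius_value_def comb[of "\<lambda>z. z \<ge> 0"] comb[of "\<lambda>z. z \<le> 0"] ..
  show ?thesis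
  proof
    assume F: "frobenius_value {a, b} n"
    obtain x y where xy: "0 \<le> y" "y < a" "n = x * a + y * b"
      using representation .
    have n': "n = (x + b) * a + (y - a) * b" using xy(3) by (simp add: algebra_simps)
    \<comment> \<open>Each failure would exhibit coefficients of one sign: \<open>(x, y)\<close>,
      then \<open>(x + b, y - a)\<close>, then \<open>(x, 0)\<close>.\<close>
    have "x < 0" using F xy unfolding frob by (metis not_less)
    moreover have "x + b > 0" using F n' xy(2) unfolding frob by (metis diff_le_0_iff_le less_imp_le not_less)
    moreover have "y \<noteq> 0" using F xy(3) \<open>x < 0\<close> unfolding frob by (metis less_imp_le order_refl)
    ultimately have "inner (- x) y" using xy by (auto simp: inner_def)
    then show "\<exists>p y. inner p y \<and> n = y * b - p * a"
      by (intro exI[of _ "- x"] exI[of _ y]) (use xy in simp)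
  next
    assume "\<exists>p y. inner p y \<and> n = y * b - p * a"
    then obtain p y where py: "inner p y" "n = - p * a + y * b" by auto
    have "\<not> (u \<ge> 0 \<and> v \<ge> 0) \<and> \<not> (u \<le> 0 \<and> v \<le> 0)" if "n = u * a + v * b" for u v
    proof -
      have "u * a + v * b = - p * a + y * b" using that py(2) by simp
      then obtain t where t: "u = - p + t * b" "v = y - t * a"
        by (rule representation_unique)
      \<comment> \<open>For \<open>t \<le> 0\<close> the first coefficient is negative and the
        second positive; for \<open>t \<ge> 1\<close> the signs are swapped.\<close>
      show ?thesis
      proof (cases "t \<le> 0")
        case True
        then have "t * b \<le> 0" "t * a \<le> 0"
          using b_pos ab by (auto simp: mult_nonpos_nonneg)
        then show ?thesis using t py(1) by (simp add: inner_def)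
      next
        case False
        then have "b \<le> t * b" "a \<le> t * a"
          using b_pos ab mult_right_mono[of 1 t b] mult_right_mono[of 1 t a] by auto
        then show ?thesis using t py(1) unfolding inner_def by linarith
      qed
    qed
    then show "frobenius_value {a, b} n" unfolding frob by blast
  qed
qed

text \<open>A point of the open rectangle that is far from the peak can step towards it inside the
  rectangle, which lengthens it.\<close>

lemma longer_frobenius_neighbour:
  assumes inner: "inner p y" and d: "d = y * b - p * a" and far: "\<bar>2 * (p + y) - (a + b)\<bar> > 1"
  shows "\<exists>s\<in>symgen {a, b}. frobenius_value {a, b} (d + s) \<and> len d < len (d + s)"
proof -
  note nb = inner_neighbours[OF inner d]
  have eq: "d + a = y * b - (p - 1) * a" "d - a = y * b - (p + 1) * a"
    "d + b = (y + 1) * b - p * a" "d - b = (y - 1) * b - p * a"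
    using d by (auto simp: algebra_simps)
  \<comment> \<open>Both moves towards the peak are blocked only at the corner
    \<open>(b - 1, a - 1)\<close> or \<open>(1, 1)\<close>, and that corner lies on the other side
    of the peak.\<close>
  consider "2 * (p + y) < a + b - 1" "inner (p + 1) y" | "2 * (p + y) < a + b - 1" "inner p (y + 1)"
    | "2 * (p + y) > a + b + 1" "inner (p - 1) y" | "2 * (p + y) > a + b + 1" "inner p (y - 1)"
    using far inner less unfolding inner_def by (smt (verit))
  then show ?thesis
  proof cases
    case 1
    then show ?thesis
      using frobenius_value_iff eq(2) nb(1,3) by (intro bexI[of _ "- a"]) (auto simp: symgen_def)
  next
    case 2
    then show ?thesis
      using frobenius_value_iff eq(3) nb(1,4) by (intro bexI[of _ b]) (auto simp: symgen_def)
  next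
    case 3
    then show ?thesis
      using frobenius_value_iff eq(1) nb(1,2) by (intro bexI[of _ a]) (auto simp: symgen_def)
  next
    case 4
    then show ?thesis
      using frobenius_value_iff eq(4) nb(1,5) by (intro bexI[of _ "- b"]) (auto simp: symgen_def)
  qed
qed

text \<open>Nothing lies above a dead end in the Cayley order, whereas a Frobenius value that is not
  a dead end lies below a longer Frobenius neighbour.\<close>

lemma dead_end_iff_maximal_frobenius:
  "dead_end {a, b} d \<longleftrightarrow> maximal_frobenius_value {a, b} d"
proof
  assume "dead_end {a, b} d"
  then show "maximal_frobenius_value {a, b} d"
    unfolding maximal_frobenius_value_def
    using dead_end_iff frobenius_value_iff cayley_le_dead_end[OF generates] by metis
next
  assume max: "maximal_frobenius_value {a, b} d"
  then obtain p y where py: "inner p y" "d = y * b - p * a"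
    unfolding maximal_frobenius_value_def frobenius_value_iff by blast
  show "dead_end {a, b} d"
  proof (rule ccontr)
    assume "\<not> dead_end {a, b} d"
    then have "\<bar>2 * (p + y) - (a + b)\<bar> > 1"
      using py dead_end_inner_iff by auto
    from longer_frobenius_neighbour[OF py this] obtain s
      where s: "s \<in> symgen {a, b}" "frobenius_value {a, b} (d + s)" "len d < len (d + s)"
      by blast
    then have "cayley_le {a, b} d (d + s)" "d + s \<noteq> d"
      using cayley_le_neighbour[OF generates] by auto
    with s(2) max show False unfolding maximal_frobenius_value_def by blast
  qed
qed

section \<open>Explicit formulas for the dead ends\<close>

lemma dead_end_even_iff:
  assumes "even (a + b)"
  shows "dead_end {a, b} d \<longleftrightarrow> (\<exists>\<alpha>\<in>{1..b - 1}. 2 * d = (a + b) * (2 * \<alpha> - b))"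
proof
  assume "dead_end {a, b} d"
  then obtain p y where py: "inner p y" "d = y * b - p * a" "\<bar>2 * (p + y) - (a + b)\<bar> \<le> 1"
    using dead_end_iff by blast
  then have "2 * (p + y) = a + b" using assms by presburger
  then have "2 * y = a + b - 2 * p" by simp
  \<comment> \<open>Eliminating \<open>y\<close> by \<open>2 * (p + y) = a + b\<close> yields the
    formula with \<open>\<alpha> = b - p\<close>.\<close>
  have "2 * d = (2 * y) * b - 2 * p * a" using py(2) by simp
  also have "\<dots> = (a + b) * (2 * (b - p) - b)"
    unfolding \<open>2 * y = a + b - 2 * p\<close> by (simp add: algebra_simps)
  finally show "\<exists>\<alpha>\<in>{1..b - 1}. 2 * d = (a + b) * (2 * \<alpha> - b)"
    using py(1) by (intro bexI[of _ "b - p"]) (auto simp: inner_def)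
next
  assume "\<exists>\<alpha>\<in>{1..b - 1}. 2 * d = (a + b) * (2 * \<alpha> - b)"
  then obtain \<alpha> where \<alpha>: "1 \<le> \<alpha>" "\<alpha> \<le> b - 1" "2 * d = (a + b) * (2 * \<alpha> - b)" by auto
  obtain h where h: "a + b = 2 * h" using assms by blast
  \<comment> \<open>Here \<open>p = b - \<alpha>\<close>, and \<open>b < a\<close> keeps
    \<open>y = h - p\<close> strictly between 0 and \<open>a\<close>.\<close>
  have "inner (b - \<alpha>) (h - (b - \<alpha>))" using \<alpha> h less by (auto simp: inner_def)
  moreover have "d = (h - (b - \<alpha>)) * b - (b - \<alpha>) * a"
  proof -
    have a: "a = 2 * h - b" using h by simp
    have "2 * d = 2 * ((h - (b - \<alpha>)) * b - (b - \<alpha>) * a)"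
      unfolding \<alpha>(3) a by (simp add: algebra_simps)
    then show ?thesis by simp
  qed
  ultimately show "dead_end {a, b} d" using dead_end_inner_iff h by simp
qed

lemma dead_end_odd_iff:
  assumes "odd (a + b)"
  shows "dead_end {a, b} d \<longleftrightarrow>
    (\<exists>\<alpha>\<in>{1..b - 1}. 2 * d = (a + b) * (2 * \<alpha> - b) + b \<or> 2 * d = (a + b) * (2 * \<alpha> - b) - b)"
proof
  assume "dead_end {a, b} d"
  then obtain p y where py: "inner p y" "d = y * b - p * a" "\<bar>2 * (p + y) - (a + b)\<bar> \<le> 1"
    using dead_end_iff by blast
  \<comment> \<open>By parity \<open>2 * (p + y)\<close> misses \<open>a + b\<close> by exactly 1;
    the sign \<open>e\<close> of the defect becomes the sign of \<open>b\<close> in the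
    formula.\<close>
  then obtain e where e: "e = 1 \<or> e = - 1" "2 * y = a + b + e - 2 * p" using assms by atomize_elim presburger
  have "2 * d = (2 * y) * b - 2 * p * a" using py(2) by simp
  also have "\<dots> = (a + b) * (2 * (b - p) - b) + e * b"
    unfolding e(2) by (simp add: algebra_simps)
  finally show "\<exists>\<alpha>\<in>{1..b - 1}. 2 * d = (a + b) * (2 * \<alpha> - b) + b \<or>
      2 * d = (a + b) * (2 * \<alpha> - b) - b"
    using py(1) e(1) by (intro bexI[of _ "b - p"]) (auto simp: inner_def)
next
  assume "\<exists>\<alpha>\<in>{1..b - 1}. 2 * d = (a + b) * (2 * \<alpha> - b) + b \<or>
      2 * d = (a + b) * (2 * \<alpha> - b) - b"
  then obtain \<alpha> e where \<alpha>: "1 \<le> \<alpha>" "\<alpha> \<le> b - 1" and e: "e = 1 \<or> e = - 1"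
      and d: "2 * d = (a + b) * (2 * \<alpha> - b) + e * b"
    by (metis atLeastAtMost_iff mult_1 mult_minus1 diff_conv_add_uminus)
  have "even (a + b + e)" using assms e by auto
  then obtain h where h: "a + b + e = 2 * h" by blast
  have "inner (b - \<alpha>) (h - (b - \<alpha>))" using \<alpha> h e less by (auto simp: inner_def)
  moreover have "d = (h - (b - \<alpha>)) * b - (b - \<alpha>) * a"
  proof -
    have a: "a = 2 * h - b - e" using h by simp
    have "2 * d = 2 * ((h - (b - \<alpha>)) * b - (b - \<alpha>) * a)"
      unfolding d a by (simp add: algebra_simps)
    then show ?thesis by simp
  qed
  moreover have "\<bar>2 * (b - \<alpha> + (h - (b - \<alpha>))) - (a + b)\<bar> \<le> 1" using h e by auto
  ultimately show "dead_end {a, b} d" using dead_end_inner_iff by simp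
qed

section \<open>Counting the dead ends\<close>

lemma inner_unique:
  assumes "inner p y" "inner p' y'" "y * b - p * a = y' * b - p' * a"
  shows "p = p'" "y = y'"
proof -
  obtain t where t: "- p' = - p + t * b" "y' = y - t * a"
    using representation_unique[of "- p'" y' "- p" y] assms(3) by auto
  \<comment> \<open>Both \<open>p\<close> and \<open>p'\<close> lie between 1 and
    \<open>b - 1\<close>, so their difference is too small to be a nonzero multiple of
    \<open>b\<close>.\<close>
  then have "\<bar>t * b\<bar> < b" using assms(1,2) by (auto simp: inner_def)
  then have "\<bar>t\<bar> * b < 1 * b" using b_pos by (simp add: abs_mult)
  then have "t = 0" using b_pos by (simp add: mult_less_cancel_right)
  with t show "p = p'" "y = y'" by auto
qed

text \<open>The dead ends fill the diagonal \<open>p + y = h\<close> of the rectangle, so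
  \<open>p\<close> enumerates them, injectively by \<open>inner_unique\<close>.\<close>

lemma card_dead_ends_even:
  assumes "even (a + b)"
  shows "int (card {d. dead_end {a, b} d}) = b - 1"
proof -
  obtain h where h: "a + b = 2 * h" using assms by blast
  let ?f = "\<lambda>p. (h - p) * b - p * a"
  have inn: "inner p (h - p)" if "p \<in> {1..b - 1}" for p
    using that h less by (auto simp: inner_def)
  have "{d. dead_end {a, b} d} = ?f ` {1..b - 1}"
  proof (intro equalityI subsetI)
    fix d assume "d \<in> {d. dead_end {a, b} d}"
    then obtain p y where py: "inner p y" "d = y * b - p * a" "\<bar>2 * (p + y) - (a + b)\<bar> \<le> 1"
      using dead_end_iff by blast
    then have "y = h - p" using h by presburger
    then show "d \<in> ?f ` {1..b - 1}" using py by (auto simp: inner_def)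
  next
    fix d assume "d \<in> ?f ` {1..b - 1}"
    then show "d \<in> {d. dead_end {a, b} d}" using dead_end_inner_iff inn h by auto
  qed
  moreover have "inj_on ?f {1..b - 1}"
    by (intro inj_onI) (use inner_unique(1) inn in blast)
  ultimately show ?thesis using b_pos by (simp add: card_image)
qed

lemma card_dead_ends_odd:
  assumes "odd (a + b)"
  shows "int (card {d. dead_end {a, b} d}) = 2 * (b - 1)"
proof -
  obtain h where h: "a + b = 2 * h + 1" using assms by (elim oddE)
  \<comment> \<open>The second component is \<open>s = p + y\<close>; \<open>h\<close> and
    \<open>h + 1\<close> are the integers at distance 1/2 from \<open>(a + b) / 2\<close>.\<close>
  let ?A = "{1..b - 1} \<times> {h, h + 1}"
  let ?f = "\<lambda>(p, s). (s - p) * b - p * a"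
  have inn: "inner p (s - p)" if "(p, s) \<in> ?A" for p s
    using that h less by (auto simp: inner_def)
  have "{d. dead_end {a, b} d} = ?f ` ?A"
  proof (intro equalityI subsetI)
    fix d assume "d \<in> {d. dead_end {a, b} d}"
    then obtain p y where py: "inner p y" "d = y * b - p * a" "\<bar>2 * (p + y) - (a + b)\<bar> \<le> 1"
      using dead_end_iff by blast
    then have "p + y = h \<or> p + y = h + 1" using h by presburger
    then have "(p, p + y) \<in> ?A" using py(1) by (auto simp: inner_def)
    moreover have "d = ?f (p, p + y)" using py(2) by simp
    ultimately show "d \<in> ?f ` ?A" by blast
  next
    fix d assume "d \<in> ?f ` ?A"
    then obtain u where u: "u \<in> ?A" "d = ?f u" by blast
    obtain p s where "u = (p, s)" by (cases u)
    with u have ps: "(p, s) \<in> ?A" "d = (s - p) * b - p * a" by auto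
    then have "\<bar>2 * (p + (s - p)) - (a + b)\<bar> \<le> 1" using h by auto
    then show "d \<in> {d. dead_end {a, b} d}" using dead_end_inner_iff inn ps by blast
  qed
  moreover have "inj_on ?f ?A"
  proof (rule inj_onI)
    fix u v assume uv: "u \<in> ?A" "v \<in> ?A" "?f u = ?f v"
    obtain p s q r where "u = (p, s)" "v = (q, r)" by (cases u, cases v)
    with uv inn[of p s] inn[of q r] inner_unique[of p "s - p" q "r - q"] show "u = v" by auto
  qed
  ultimately show ?thesis using b_pos by (simp add: card_image card_cartesian_product)
qed

section \<open>Strictness and length of the dead ends\<close>

lemma dead_end_even:
  assumes "even (a + b)" "dead_end {a, b} d"
  shows "strict_dead_end {a, b} d" "2 * len d = a + b"
proof -
  obtain p y where py: "inner p y" "d = y * b - p * a" "\<bar>2 * (p + y) - (a + b)\<bar> \<le> 1"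
    using assms(2) dead_end_iff by blast
  then have "2 * (p + y) = a + b" using assms(1) by presburger
  then show "strict_dead_end {a, b} d" "2 * len d = a + b"
    using strict_dead_end_inner_iff inner_neighbours(1) py by auto
qed

lemma dead_end_odd:
  assumes "odd (a + b)" "dead_end {a, b} d"
  shows "\<not> strict_dead_end {a, b} d" "2 * len d = a + b - 1"
proof -
  obtain p y where py: "inner p y" "d = y * b - p * a" "\<bar>2 * (p + y) - (a + b)\<bar> \<le> 1"
    using assms(2) dead_end_iff by blast
  then have "2 * (p + y) = a + b + 1 \<or> 2 * (p + y) = a + b - 1" using assms(1) by presburger
  then show "\<not> strict_dead_end {a, b} d" "2 * len d = a + b - 1"
    using strict_dead_end_inner_iff[OF py(1)] inner_neighbours(1)[OF py(1)] py(2) by auto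
qed

end

text \<open>Turns the halved real formulas of the theorem into the integer equations used for the
  dead ends.\<close>

lemma real_of_int_eq_half_iff: "real_of_int d = real_of_int n / 2 \<longleftrightarrow> 2 * d = n"
  by linarith

theorem theorem2:
  fixes a b :: int
  assumes "coprime a b" and "b \<ge> 1" and "a > b"
  shows "{d. dead_end {a, b} d} = {d. maximal_frobenius_value {a, b} d} \<and>
    (even (a + b) \<longrightarrow>
       int (card {d. dead_end {a, b} d}) = b - 1 \<and>
       (\<forall>d. dead_end {a, b} d \<longrightarrow> strict_dead_end {a, b} d) \<and>
       (\<forall>d. dead_end {a, b} d \<longrightarrow>
            real (word_length {a, b} d) = real_of_int (a + b) / 2) \<and>
       {d. dead_end {a, b} d} =
         {d. \<exists>\<alpha>\<in>{1..b - 1}.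
            real_of_int d = real_of_int ((a + b) * (2 * \<alpha> - b)) / 2}) \<and>
    (odd (a + b) \<longrightarrow>
       int (card {d. dead_end {a, b} d}) = 2 * (b - 1) \<and>
       (\<forall>d. dead_end {a, b} d \<longrightarrow> \<not> strict_dead_end {a, b} d) \<and>
       (\<forall>d. dead_end {a, b} d \<longrightarrow>
            real (word_length {a, b} d) = real_of_int (a + b - 1) / 2) \<and>
       {d. dead_end {a, b} d} =
         {d. \<exists>\<alpha>\<in>{1..b - 1}.
            real_of_int d = real_of_int ((a + b) * (2 * \<alpha> - b) + b) / 2 \<or>
            real_of_int d = real_of_int ((a + b) * (2 * \<alpha> - b) - b) / 2})"
proof -
  interpret coprime_pair a b using assms by unfold_locales
  \<comment> \<open>The left side is cast from \<open>nat\<close>, so it is first read as the real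
    value of \<open>len d\<close>; only then does the halving rule apply.\<close>
  have length_even: "real (word_length {a, b} d) = real_of_int (a + b) / 2"
    if "even (a + b)" "dead_end {a, b} d" for d
    using dead_end_even(2)[OF that] by (metis real_of_int_eq_half_iff of_int_of_nat_eq)
  have length_odd: "real (word_length {a, b} d) = real_of_int (a + b - 1) / 2"
    if "odd (a + b)" "dead_end {a, b} d" for d
    using dead_end_odd(2)[OF that] by (metis real_of_int_eq_half_iff of_int_of_nat_eq)
  \<comment> \<open>Once the formulas are integer equations, each conjunct is the conclusion of one
    of the listed rules.\<close>
  show ?thesis
    unfolding real_of_int_eq_half_iff
    by (intro conjI impI allI Collect_cong; rule dead_end_iff_maximal_frobenius
        card_dead_ends_even dead_end_even(1) length_even dead_end_even_iff
        card_dead_ends_odd dead_end_odd(1) length_odd dead_end_odd_iff; assumption)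
qed

end
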